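(* Let $k$ be a field of characteristic zero and let $d\ge 1$ be an integer. Let $\mathcal T_d$ be the $k$-vector space with basis the set of (isomorphism classes of) rooted trees whose vertices are coloured with $d$ colours $1,\dots,d$, endowed with the bilinear grafting product $\to$. Then $(\mathcal T_d,\to)$ is the free (left) pre-Lie algebra with $d$ generators, the generators being the one-vertex trees $\bullet_1,\dots,\bullet_d$. That is, $(\mathcal T_d,\to)$ is a left pre-Lie algebra, and for every left pre-Lie algebra $(A,\rhd)$ over $k$ and every $a_1,\dots,a_d\in A$ there is a unique morphism of pre-Lie algebras $F:\mathcal T_d\to A$ such that $F(\bullet_i)=a_i$ for all $i=1,\dots,d$.
   Context: A left pre-Lie algebra over $k$ is a $k$-vector space $A$ with a bilinear product $\rhd$ such that $(a\rhd b)\rhd c-a\rhd(b\rhd c)=(b\rhd a)\rhd c-b\rhd(a\rhd c)$ for all $a,b,c\in A$. A morphism of pre-Lie algebras is a linear map compatible with the products. A rooted tree is a nonempty finite tree with a distinguished vertex (the root); the trees are non-planar (branches are not ordered). A colouring assigns to each vertex one of the $d$ colours; isomorphisms respect the root and the colours. For coloured rooted trees $s,t$, the grafting $s\to t$ is the sum, over all vertices $v$ of $t$, of the coloured rooted tree obtained by joining the root of $s$ to $v$ by a new edge (so the root of $s$ becomes a child of $v$), the root of the result being the root of $t$. The product is extended bilinearly. *)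

theory Defs
  imports Complex_Main "HOL-Library.Poly_Mapping" "HOL-Combinatorics.Permutations"
begin

section \<open>Left pre-Lie algebras\<close>

locale left_pre_lie_algebra = vector_space scale
  for scale :: "'k::field \<Rightarrow> 'a::ab_group_add \<Rightarrow> 'a" +
  fixes prd :: "'a \<Rightarrow> 'a \<Rightarrow> 'a"
  assumes linear_right: "\<And>a. Vector_Spaces.linear scale scale (\<lambda>b. prd a b)"
    and linear_left: "\<And>b. Vector_Spaces.linear scale scale (\<lambda>a. prd a b)"
    and left_pre_lie:
      "\<And>a b c. prd (prd a b) c - prd a (prd b c) = prd (prd b a) c - prd b (prd a c)"

definition pre_lie_morphism ::
  "('k::field \<Rightarrow> 'a::ab_group_add \<Rightarrow> 'a) \<Rightarrow> ('a \<Rightarrow> 'a \<Rightarrow> 'a) \<Rightarrow>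
   ('k \<Rightarrow> 'b::ab_group_add \<Rightarrow> 'b) \<Rightarrow> ('b \<Rightarrow> 'b \<Rightarrow> 'b) \<Rightarrow> ('a \<Rightarrow> 'b) \<Rightarrow> bool" where
  "pre_lie_morphism scale1 prd1 scale2 prd2 F \<longleftrightarrow>
     Vector_Spaces.linear scale1 scale2 F \<and> (\<forall>x y. F (prd1 x y) = prd2 (F x) (F y))"


section \<open>Coloured non-planar rooted trees\<close>

text \<open>
  An element of the following type is an isomorphism class of finite rooted trees with vertices
  coloured in \<open>'c\<close>: it is determined by the colour of the root and the multiset of the
  (classes of the) branches at the root. See \<open>shape_surj\<close> and \<open>shape_eq_iff\<close> below.
\<close>

datatype 'c tree = Node 'c "'c tree multiset"

definition one_vertex :: "'c \<Rightarrow> 'c tree" where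
  "one_vertex c = Node c {#}"

text \<open>
  The multiset of all trees obtained by joining the root of \<open>s\<close> to a vertex of \<open>t\<close>, with one
  entry for each vertex. A vertex of \<open>Node c M\<close> is either the root, or a vertex of one of the
  branches; as \<open>t\<close> ranges over the multiset \<open>M\<close>, equal branches are counted separately.
  See \<open>grafts_shape\<close> below for the description by explicit vertices.
\<close>

function grafts :: "'c tree \<Rightarrow> 'c tree \<Rightarrow> 'c tree multiset" where
  "grafts s (Node c M) =
     {#Node c (add_mset s M)#} +
     (\<Sum>t\<in>#M. {#Node c (add_mset t' (M - {#t#})). t' \<in># grafts s t#})"
  by pat_completeness auto
termination
  by (relation "measure (size \<circ> snd)") (auto dest!: multi_member_split)


section \<open>The space spanned by the trees and the grafting product\<close>

definition fscale :: "'k::field \<Rightarrow> ('x \<Rightarrow>\<^sub>0 'k) \<Rightarrow> ('x \<Rightarrow>\<^sub>0 'k)" where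
  "fscale a x = Poly_Mapping.map (\<lambda>b. a * b) x"

definition basis :: "'x \<Rightarrow> ('x \<Rightarrow>\<^sub>0 'k::field)" where
  "basis t = Poly_Mapping.single t 1"

definition graft_basis :: "'c tree \<Rightarrow> 'c tree \<Rightarrow> ('c tree \<Rightarrow>\<^sub>0 'k::field)" where
  "graft_basis s t = (\<Sum>t'\<in>#grafts s t. basis t')"

definition graft :: "('c tree \<Rightarrow>\<^sub>0 'k::field) \<Rightarrow> ('c tree \<Rightarrow>\<^sub>0 'k) \<Rightarrow> ('c tree \<Rightarrow>\<^sub>0 'k)" where
  "graft x y =
     (\<Sum>s\<in>Poly_Mapping.keys x. \<Sum>t\<in>Poly_Mapping.keys y.
        fscale (Poly_Mapping.lookup x s * Poly_Mapping.lookup y t) (graft_basis s t))"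


section \<open>Isomorphism and grafting in terms of explicit vertices\<close>

text \<open>
  To speak of individual vertices one needs a tree rather than an isomorphism class. Every
  class is represented by a tree whose branches are listed in some order, and the vertices of
  such a tree are the paths of branch numbers leading from the root to them. The order is
  irrelevant: \<open>tree_iso\<close> preserves only the root, the colours and the edges, and two such trees
  have the same \<open>shape\<close> if and only if they are isomorphic in this sense.
\<close>

datatype 'c ordered_tree = ONode 'c "'c ordered_tree list"

primrec shape :: "'c ordered_tree \<Rightarrow> 'c tree" where
  "shape (ONode c ts) = Node c (mset (map shape ts))"

function vertices :: "'c ordered_tree \<Rightarrow> nat list set" where
  "vertices (ONode c ts) =
     insert [] (\<Union>i\<in>{..<length ts}. (\<lambda>p. i # p) ` vertices (ts ! i))"
  by pat_completeness auto
termination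
  by (relation "measure size") (auto simp: less_Suc_eq_le intro!: size_list_estimation')

fun colour_at :: "'c ordered_tree \<Rightarrow> nat list \<Rightarrow> 'c" where
  "colour_at (ONode c ts) [] = c"
| "colour_at (ONode c ts) (i # p) = colour_at (ts ! i) p"

definition child :: "nat list \<Rightarrow> nat list \<Rightarrow> bool" where
  "child p q \<longleftrightarrow> (\<exists>i. q = p @ [i])"

definition tree_iso ::
  "(nat list \<Rightarrow> nat list) \<Rightarrow> 'c ordered_tree \<Rightarrow> 'c ordered_tree \<Rightarrow> bool" where
  "tree_iso f t u \<longleftrightarrow>
     bij_betw f (vertices t) (vertices u) \<and> f [] = [] \<and>
     (\<forall>p\<in>vertices t. colour_at u (f p) = colour_at t p) \<and>
     (\<forall>p\<in>vertices t. \<forall>q\<in>vertices t. child (f p) (f q) \<longleftrightarrow> child p q)"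

fun graft_at :: "'c ordered_tree \<Rightarrow> 'c ordered_tree \<Rightarrow> nat list \<Rightarrow> 'c ordered_tree" where
  "graft_at s (ONode c ts) [] = ONode c (s # ts)"
| "graft_at s (ONode c ts) (i # p) = ONode c (ts[i := graft_at s (ts ! i) p])"

lemma shape_surj: "\<exists>t'. shape t' = t"
proof (induction t)
  case (Node c M)
  then obtain f where f: "\<And>t. t \<in># M \<Longrightarrow> shape (f t) = t" by metis
  obtain ts where ts: "mset ts = M" using ex_mset by blast
  have "shape (ONode c (map f ts)) = Node c M"
    using f ts by (auto simp: o_def intro!: image_mset_cong[where g = "\<lambda>x. x", simplified])
  then show ?case by blast
qed

lemma finite_vertices: "finite (vertices t)"
  by (induction t) (auto simp: vertices.simps intro!: finite_imageI)

lemma Nil_in_vertices [simp]: "[] \<in> vertices t"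
  by (cases t) auto

lemma Cons_in_vertices [simp]:
  "i # p \<in> vertices (ONode c ts) \<longleftrightarrow> i < length ts \<and> p \<in> vertices (ts ! i)"
  by auto

declare vertices.simps [simp del]

lemma vertices_prefix: "p @ q \<in> vertices t \<Longrightarrow> p \<in> vertices t"
proof (induction p arbitrary: t)
  case (Cons i p)
  then show ?case by (cases t) auto
qed simp

lemma child_simps [simp]:
  "child [] q \<longleftrightarrow> (\<exists>i. q = [i])" "\<not> child p []" "child (i # p) (j # q) \<longleftrightarrow> i = j \<and> child p q"
  "child (i # p) [j] \<longleftrightarrow> False"
  by (auto simp: child_def)

lemma shape_eq_imp_iso: "shape t = shape u \<Longrightarrow> \<exists>f. tree_iso f t u"
proof (induction t arbitrary: u)
  case (ONode c ts)
  obtain d us where u: "u = ONode d us" by (cases u)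
  from ONode.prems have c: "c = d" and "mset (map shape us) = mset (map shape ts)"
    by (auto simp: u)
  from mset_eq_permutation[OF this(2)] obtain \<pi>
    where \<pi>: "\<pi> permutes {..<length ts}" and perm: "permute_list \<pi> (map shape ts) = map shape us"
    by auto
  have len: "length us = length ts" using arg_cong[OF perm, of length] by simp
  define \<sigma> where "\<sigma> = inv \<pi>"
  have \<sigma>: "\<sigma> permutes {..<length ts}" unfolding \<sigma>_def using \<pi> by (rule permutes_inv)
  have \<sigma>_less: "\<sigma> i < length ts \<longleftrightarrow> i < length ts" for i
    using permutes_in_image[OF \<sigma>, of i] by simp
  have \<sigma>_inj: "\<sigma> i = \<sigma> j \<longleftrightarrow> i = j" for i j
    using permutes_inj[OF \<sigma>] by (auto simp: inj_def)
  have \<sigma>_surj: "\<exists>i<length ts. \<sigma> i = j" if "j < length ts" for j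
    using permutes_image[OF \<sigma>] that by (metis image_iff lessThan_iff)
  have sh: "shape (ts ! i) = shape (us ! \<sigma> i)" if i: "i < length ts" for i
  proof -
    have "shape (us ! \<sigma> i) = permute_list \<pi> (map shape ts) ! \<sigma> i"
      using i len \<sigma>_less by (simp add: perm)
    also have "\<dots> = map shape ts ! \<pi> (\<sigma> i)"
      using i \<pi> \<sigma>_less by (subst permute_list_nth) auto
    also have "\<dots> = shape (ts ! i)"
      using i by (simp add: \<sigma>_def permutes_inverses[OF \<pi>])
    finally show ?thesis by simp
  qed
  have "\<forall>i. \<exists>g. i < length ts \<longrightarrow> tree_iso g (ts ! i) (us ! \<sigma> i)"
    using ONode.IH sh by (metis nth_mem)
  then obtain g where g: "\<And>i. i < length ts \<Longrightarrow> tree_iso (g i) (ts ! i) (us ! \<sigma> i)" by metis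
  define f where "f p = (case p of [] \<Rightarrow> [] | i # p \<Rightarrow> \<sigma> i # g i p)" for p
  have g_bij: "bij_betw (g i) (vertices (ts ! i)) (vertices (us ! \<sigma> i))"
    and g_Nil: "g i [] = []"
    and g_col: "\<And>p. p \<in> vertices (ts ! i) \<Longrightarrow> colour_at (us ! \<sigma> i) (g i p) = colour_at (ts ! i) p"
    and g_child: "\<And>p q. p \<in> vertices (ts ! i) \<Longrightarrow> q \<in> vertices (ts ! i) \<Longrightarrow>
                    child (g i p) (g i q) \<longleftrightarrow> child p q"
    if "i < length ts" for i
    using g[OF that] by (auto simp: tree_iso_def)
  have g_eq_Nil: "g i p = [] \<longleftrightarrow> p = []" if "i < length ts" "p \<in> vertices (ts ! i)" for i p
    using g_bij[OF that(1)] g_Nil[OF that(1)] that(2)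
    by (metis Nil_in_vertices bij_betw_imp_inj_on inj_onD)
  have "bij_betw f (vertices (ONode c ts)) (vertices (ONode d us))"
  proof (rule bij_betwI')
    fix p q assume "p \<in> vertices (ONode c ts)" "q \<in> vertices (ONode c ts)"
    then show "(f p = f q) = (p = q)"
      using \<sigma>_inj by (cases p; cases q)
        (auto simp: f_def inj_on_eq_iff[OF bij_betw_imp_inj_on[OF g_bij]])
  next
    fix p assume "p \<in> vertices (ONode c ts)"
    then show "f p \<in> vertices (ONode d us)"
      using g_bij \<sigma>_less len by (cases p)
        (auto simp: f_def bij_betw_def)
  next
    fix q assume q: "q \<in> vertices (ONode d us)"
    show "\<exists>p\<in>vertices (ONode c ts). q = f p"
    proof (cases q)
      case Nil
      then show ?thesis by (intro bexI[of _ "[]"]) (auto simp: f_def)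
    next
      case (Cons j q')
      with q len obtain i where i: "i < length ts" "\<sigma> i = j" using \<sigma>_surj by auto
      with Cons q have "q' \<in> g i ` vertices (ts ! i)"
        using bij_betw_imp_surj_on[OF g_bij[OF i(1)]] by simp
      then obtain p where "p \<in> vertices (ts ! i)" "g i p = q'" by blast
      then show ?thesis using i Cons by (intro bexI[of _ "i # p"]) (auto simp: f_def)
    qed
  qed
  moreover have "colour_at (ONode d us) (f p) = colour_at (ONode c ts) p"
    if "p \<in> vertices (ONode c ts)" for p
    using that g_col c by (cases p) (auto simp: f_def)
  moreover have "child (f p) (f q) \<longleftrightarrow> child p q"
    if "p \<in> vertices (ONode c ts)" "q \<in> vertices (ONode c ts)" for p q
    using that g_child \<sigma>_inj g_eq_Nil by (cases p; cases q)
      (auto simp: f_def)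
  ultimately have "tree_iso f (ONode c ts) u"
    by (simp add: tree_iso_def u f_def)
  then show ?case by blast
qed

lemma iso_imp_shape_eq: "tree_iso f t u \<Longrightarrow> shape t = shape u"
proof (induction t arbitrary: u f)
  case (ONode c ts)
  obtain d us where u: "u = ONode d us" by (cases u)
  let ?V = "vertices (ONode c ts)" and ?W = "vertices (ONode d us)"
  from ONode.prems have bij: "bij_betw f ?V ?W" and f_Nil: "f [] = []"
    and col: "\<And>p. p \<in> ?V \<Longrightarrow> colour_at (ONode d us) (f p) = colour_at (ONode c ts) p"
    and child: "\<And>p q. p \<in> ?V \<Longrightarrow> q \<in> ?V \<Longrightarrow> child (f p) (f q) \<longleftrightarrow> child p q"
    by (auto simp: u tree_iso_def)
  have inj: "f p = f q \<longleftrightarrow> p = q" if "p \<in> ?V" "q \<in> ?V" for p q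
    using inj_on_eq_iff[OF bij_betw_imp_inj_on[OF bij]] that by blast
  have into: "f p \<in> ?W" if "p \<in> ?V" for p
    using bij that by (auto simp: bij_betw_def)
  have surj: "\<exists>p\<in>?V. q = f p" if "q \<in> ?W" for q
    using bij that by (auto simp: bij_betw_def)
  have cd: "c = d" using col[of "[]"] f_Nil by simp
  have "\<exists>j. f [i] = [j]" if "i < length ts" for i
    using child[of "[]" "[i]"] that f_Nil by simp
  then obtain \<pi> where \<pi>: "\<And>i. i < length ts \<Longrightarrow> f [i] = [\<pi> i]" by metis
  define g where "g i p = tl (f (i # p))" for i p
  have f_Cons: "f (i # p) = \<pi> i # g i p" if i: "i < length ts" and p: "p \<in> vertices (ts ! i)" for i p
    using p
  proof (induction p rule: rev_induct)
    case Nil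
    then show ?case using \<pi>[OF i] by (simp add: g_def)
  next
    case (snoc j p)
    have p: "p \<in> vertices (ts ! i)" using snoc.prems by (rule vertices_prefix)
    have "child (i # p) (i # p @ [j])" by (simp add: child_def)
    then have "child (f (i # p)) (f (i # p @ [j]))"
      using child[of "i # p" "i # p @ [j]"] i p snoc.prems by simp
    then obtain k where "f (i # p @ [j]) = f (i # p) @ [k]" by (auto simp: child_def)
    then have "f (i # p @ [j]) = \<pi> i # g i p @ [k]" unfolding snoc.IH[OF p] by simp
    then show ?case by (simp add: g_def[of i "p @ [j]"])
  qed
  have \<pi>_less: "\<pi> i < length us" if "i < length ts" for i
    using into[of "[i]"] \<pi>[OF that] that by simp
  have \<pi>_bij: "bij_betw \<pi> {..<length ts} {..<length us}"
  proof (rule bij_betwI')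
    fix i j assume "i \<in> {..<length ts}" "j \<in> {..<length ts}"
    then show "(\<pi> i = \<pi> j) = (i = j)"
      using inj[of "[i]" "[j]"] \<pi>[of i] \<pi>[of j] by simp
  next
    fix j assume "j \<in> {..<length us}"
    then obtain q where q: "q \<in> ?V" "[j] = f q" using surj[of "[j]"] by auto
    have "child [] q" using child[of "[]" q] q f_Nil by (metis Nil_in_vertices child_simps(1))
    then obtain i where "q = [i]" by auto
    then show "\<exists>i\<in>{..<length ts}. j = \<pi> i" using q \<pi>[of i] by auto
  qed (use \<pi>_less in auto)
  have sh: "shape (ts ! i) = shape (us ! \<pi> i)" if i: "i < length ts" for i
  proof (rule ONode.IH)
    show "ts ! i \<in> set ts" using i by simp
    have "bij_betw (g i) (vertices (ts ! i)) (vertices (us ! \<pi> i))"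
    proof (rule bij_betwI')
      fix p q assume "p \<in> vertices (ts ! i)" "q \<in> vertices (ts ! i)"
      then show "(g i p = g i q) = (p = q)"
        using inj[of "i # p" "i # q"] f_Cons[OF i, of p] f_Cons[OF i, of q] i
        by simp
    next
      fix p assume "p \<in> vertices (ts ! i)"
      then show "g i p \<in> vertices (us ! \<pi> i)"
        using into[of "i # p"] f_Cons[OF i, of p] i by simp
    next
      fix q assume "q \<in> vertices (us ! \<pi> i)"
      then obtain r where r: "r \<in> ?V" "\<pi> i # q = f r"
        using surj[of "\<pi> i # q"] \<pi>_less[OF i] by auto
      obtain i' p where r': "r = i' # p" using r f_Nil by (cases r) auto
      with r have i': "i' < length ts" and p: "p \<in> vertices (ts ! i')" by auto
      with r r' f_Cons[OF i' p] have "\<pi> i' = \<pi> i" "q = g i' p" by auto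
      then have "i' = i" using \<pi>_bij i i' by (auto simp: bij_betw_def inj_on_def)
      then show "\<exists>p\<in>vertices (ts ! i). q = g i p" using \<open>q = g i' p\<close> p by blast
    qed
    moreover have "g i [] = []" using \<pi>[OF i] by (simp add: g_def)
    moreover have "colour_at (us ! \<pi> i) (g i p) = colour_at (ts ! i) p"
      if "p \<in> vertices (ts ! i)" for p
      using col[of "i # p"] f_Cons[OF i that] that i by simp
    moreover have "child (g i p) (g i q) \<longleftrightarrow> child p q"
      if "p \<in> vertices (ts ! i)" "q \<in> vertices (ts ! i)" for p q
      using child[of "i # p" "i # q"] f_Cons[OF i that(1)] f_Cons[OF i that(2)] that i
      by simp
    ultimately show "tree_iso (g i) (ts ! i) (us ! \<pi> i)" by (simp add: tree_iso_def)
  qed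
  have mset_nth: "mset xs = image_mset (\<lambda>i. xs ! i) (mset_set {..<length xs})" for xs :: "'c tree list"
    by (metis atLeast0LessThan map_nth mset_map mset_upt)
  have "mset (map shape ts) = image_mset (\<lambda>i. shape (ts ! i)) (mset_set {..<length ts})"
    by (subst mset_nth) (auto intro: image_mset_cong)
  also have "\<dots> = image_mset (\<lambda>i. shape (us ! \<pi> i)) (mset_set {..<length ts})"
    by (rule image_mset_cong) (simp add: sh)
  also have "\<dots> = image_mset (\<lambda>j. shape (us ! j)) (image_mset \<pi> (mset_set {..<length ts}))"
    by (simp add: multiset.map_comp o_def)
  also have "image_mset \<pi> (mset_set {..<length ts}) = mset_set {..<length us}"
    using \<pi>_bij by (simp add: image_mset_mset_set bij_betw_def)
  also have "image_mset (\<lambda>j. shape (us ! j)) (mset_set {..<length us}) = mset (map shape us)"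
    by (subst mset_nth) (auto intro: image_mset_cong)
  finally show ?case by (simp add: u cd)
qed

theorem shape_eq_iff: "shape t = shape u \<longleftrightarrow> (\<exists>f. tree_iso f t u)"
  using shape_eq_imp_iso iso_imp_shape_eq by blast

lemma grafts_shape:
  "grafts (shape s) (shape t) = image_mset (\<lambda>p. shape (graft_at s t p)) (mset_set (vertices t))"
proof (induction t)
  case (ONode c ts)
  let ?n = "length ts"
  let ?B = "\<lambda>i. (\<lambda>p. i # p) ` vertices (ts ! i)"
  let ?M = "mset (map shape ts)"
  let ?g = "\<lambda>t. {#Node c (add_mset t' (?M - {#t#})). t' \<in># grafts (shape s) t#}"
  let ?h = "\<lambda>p. shape (graft_at s (ONode c ts) p)"
  have union: "mset_set (\<Union>i\<in>{..<m}. ?B i) = (\<Sum>i<m. mset_set (?B i))" for m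
  proof (induction m)
    case (Suc m)
    have "mset_set ((\<Union>i\<in>{..<m}. ?B i) \<union> ?B m) = mset_set (\<Union>i\<in>{..<m}. ?B i) + mset_set (?B m)"
      by (rule mset_set_Union) (auto simp: finite_vertices)
    then show ?case using Suc by (simp add: lessThan_Suc Un_commute add.commute)
  qed simp
  have image_sum: "image_mset ?h (\<Sum>i<m. A i) = (\<Sum>i<m. image_mset ?h (A i))" for m :: nat and A
    by (induction m) simp_all
  have branch: "image_mset ?h (mset_set (?B i)) = ?g (shape (ts ! i))" if i: "i < ?n" for i
  proof -
    have "image_mset ?h (mset_set (?B i)) = image_mset ?h (image_mset (\<lambda>p. i # p) (mset_set (vertices (ts ! i))))"
      by (simp add: image_mset_mset_set)
    also have "\<dots> = image_mset (\<lambda>p. Node c (add_mset (shape (graft_at s (ts ! i) p)) (?M - {#shape (ts ! i)#})))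
        (mset_set (vertices (ts ! i)))"
      using i by (simp add: multiset.map_comp o_def map_update mset_update del: mset_map)
    also have "\<dots> = ?g (shape (ts ! i))"
      using ONode.IH[of "ts ! i"] i by (simp add: multiset.map_comp o_def)
    finally show ?thesis .
  qed
  have "(\<Sum>t\<in>#?M. ?g t) = sum_list (map (\<lambda>t. ?g (shape t)) ts)"
    by (simp only: mset_map[symmetric] sum_mset_sum_list map_map o_def)
  also have "\<dots> = (\<Sum>i<?n. ?g (shape (ts ! i)))"
    by (simp add: sum_list_sum_nth atLeast0LessThan)
  also have "\<dots> = (\<Sum>i<?n. image_mset ?h (mset_set (?B i)))"
    using branch by simp
  also have "\<dots> = image_mset ?h (mset_set (\<Union>i\<in>{..<?n}. ?B i))"
    unfolding union image_sum ..
  finally have eq: "(\<Sum>t\<in>#?M. ?g t) = image_mset ?h (mset_set (\<Union>i\<in>{..<?n}. ?B i))" .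
  have "mset_set (vertices (ONode c ts)) = add_mset [] (mset_set (\<Union>i\<in>{..<?n}. ?B i))"
    by (simp add: vertices.simps, subst mset_set.insert) (auto simp: finite_vertices)
  then show ?case using eq by simp
qed

end

theory Submission imports Defs begin

text \<open>
  The value of a tree in a pre-Lie algebra is computed by the symmetric braces of Oudom and Guin:
  the product extends to an action of multisets of elements by
  \<open>{a, x\<^sub>1, \<dots>, x\<^sub>n} b = a \<rhd> ({x\<^sub>1, \<dots>, x\<^sub>n} b) - (\<Sum>i. {x\<^sub>1, \<dots>, a \<rhd> x\<^sub>i, \<dots>, x\<^sub>n} b)\<close>,
  whose right-hand side is symmetric in \<open>a\<close> and the \<open>x\<^sub>i\<close> precisely because of the pre-Lie identity.
  A tree with root colour \<open>c\<close> is sent to the brace of the values of its branches acting on the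
  generator of colour \<open>c\<close>; the recursion for the brace then says that grafting goes to the product.
  For uniqueness the same recursion is read in the tree algebra: a tree with branches \<open>s, M\<close> is
  \<open>s\<close> grafted to the tree with branches \<open>M\<close>, minus trees with as many vertices but fewer branches
  at the root.
\<close>

section \<open>Grafting of trees\<close>

lemma sum_mset_sum_mset: "(\<Sum>x\<in>#(\<Sum>t\<in>#N. G t). f x) = (\<Sum>t\<in>#N. \<Sum>x\<in>#G t. f x)"
  by (induction N) auto

lemma image_mset_sum_mset: "image_mset f (\<Sum>t\<in>#N. G t) = (\<Sum>t\<in>#N. image_mset f (G t))"
  by (induction N) auto

lemma sum_mset_add_mset: "(\<Sum>t\<in>#N. add_mset (f t) (g t)) = image_mset f N + (\<Sum>t\<in>#N. g t)"
  by (induction N) auto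

lemma sum_mset_image_mset_swap:
  "(\<Sum>x\<in>#M. image_mset (\<lambda>y. f x y) N) = (\<Sum>y\<in>#N. image_mset (\<lambda>x. f x y) M)"
  by (induction M) (auto simp: sum_mset_add_mset)

text \<open>These are the grafts onto \<open>Node c M\<close> away from its root. They are kept as
  forests without a root, so that \<open>M\<close> can be treated one branch at a time.\<close>

definition branch_grafts :: "'c tree \<Rightarrow> 'c tree multiset \<Rightarrow> 'c tree multiset multiset" where
  "branch_grafts s M = (\<Sum>t\<in>#M. {#add_mset t' (M - {#t#}). t' \<in># grafts s t#})"

lemma branch_grafts_empty [simp]: "branch_grafts s {#} = {#}"
  by (simp add: branch_grafts_def)

text \<open>Leibniz rule: \<open>s\<close> lands either in \<open>x\<close> or in a branch from
  \<open>M\<close>, and in the second case \<open>x\<close> is only carried along.\<close>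

lemma branch_grafts_add_mset [simp]:
  "branch_grafts s (add_mset x M) =
     {#add_mset t' M. t' \<in># grafts s x#} + image_mset (add_mset x) (branch_grafts s M)"
proof -
  have "(\<Sum>t\<in>#M. {#add_mset t' (add_mset x M - {#t#}). t' \<in># grafts s t#}) =
      (\<Sum>t\<in>#M. image_mset (add_mset x) {#add_mset t' (M - {#t#}). t' \<in># grafts s t#})"
    by (intro arg_cong[of _ _ sum_mset] image_mset_cong)
      (auto simp: multiset.map_comp o_def add_mset_commute)
  then show ?thesis by (simp add: branch_grafts_def image_mset_sum_mset)
qed

lemma grafts_Node:
  "grafts s (Node c M) = image_mset (Node c) (add_mset (add_mset s M) (branch_grafts s M))"
  by (simp add: branch_grafts_def image_mset_sum_mset multiset.map_comp o_def)

declare grafts.simps [simp del]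

text \<open>By the Leibniz rule two graftings both meet \<open>x\<close>, both meet
  \<open>M\<close>, or meet one each. The assumption settles the first kind, induction the second,
  and the third is symmetric in \<open>s\<close> and \<open>t\<close>. Sums replace differences
  because multisets have no additive inverses.\<close>

lemma branch_grafts_pre_lie:
  assumes "\<And>u. u \<in># M \<Longrightarrow>
      (\<Sum>w\<in>#grafts t u. grafts s w) + (\<Sum>w\<in>#grafts t s. grafts w u) =
      (\<Sum>w\<in>#grafts s u. grafts t w) + (\<Sum>w\<in>#grafts s t. grafts w u)"
  shows "(\<Sum>N\<in>#branch_grafts t M. branch_grafts s N) + (\<Sum>w\<in>#grafts t s. branch_grafts w M) =
      (\<Sum>N\<in>#branch_grafts s M. branch_grafts t N) + (\<Sum>w\<in>#grafts s t. branch_grafts w M)"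
  using assms
proof (induction M)
  case (add x M)
  have expand: "(\<Sum>N\<in>#branch_grafts t (add_mset x M). branch_grafts s N) +
        (\<Sum>w\<in>#grafts t s. branch_grafts w (add_mset x M)) =
      {#add_mset t' M. t' \<in># (\<Sum>w\<in>#grafts t x. grafts s w) + (\<Sum>w\<in>#grafts t s. grafts w x)#} +
      image_mset (add_mset x) ((\<Sum>N\<in>#branch_grafts t M. branch_grafts s N) +
        (\<Sum>w\<in>#grafts t s. branch_grafts w M)) +
      ((\<Sum>w\<in>#grafts t x. image_mset (add_mset w) (branch_grafts s M)) +
       (\<Sum>w\<in>#grafts s x. image_mset (add_mset w) (branch_grafts t M)))" for s t
    by (simp add: image_mset_sum_mset sum_mset.distrib multiset.map_comp o_def
        sum_mset_image_mset_swap[where M = "grafts s x"] ac_simps)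
  show ?case
    unfolding expand using add by (simp add: ac_simps)
qed simp

text \<open>After \<open>t\<close> is grafted onto \<open>u\<close>, \<open>s\<close> goes either
  into the new copy of \<open>t\<close> or to a vertex of \<open>u\<close>. The first kind amounts
  to grafting \<open>s\<close> into \<open>t\<close> and the result onto \<open>u\<close>; the
  second is symmetric in \<open>s\<close> and \<open>t\<close>.\<close>

lemma grafts_pre_lie:
  "(\<Sum>w\<in>#grafts t u. grafts s w) + (\<Sum>w\<in>#grafts t s. grafts w u) =
   (\<Sum>w\<in>#grafts s u. grafts t w) + (\<Sum>w\<in>#grafts s t. grafts w u)"
proof (induction u)
  case (Node c M)
  \<comment> \<open>The correction term supplies \<open>grafts t s\<close> at the root, so only the
    last summand is not visibly symmetric in \<open>s\<close> and \<open>t\<close>.\<close>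
  have expand: "(\<Sum>w\<in>#grafts t (Node c M). grafts s w) + (\<Sum>w\<in>#grafts t s. grafts w (Node c M)) =
      image_mset (Node c)
        (add_mset (add_mset s (add_mset t M))
          ({#add_mset t' M. t' \<in># grafts s t + grafts t s#} +
           image_mset (add_mset t) (branch_grafts s M) + image_mset (add_mset s) (branch_grafts t M) +
           ((\<Sum>N\<in>#branch_grafts t M. branch_grafts s N) + (\<Sum>w\<in>#grafts t s. branch_grafts w M))))"
    for s t
    by (simp add: grafts_Node image_mset_sum_mset sum_mset.distrib multiset.map_comp o_def
       sum_mset_add_mset ac_simps)
  have "(\<Sum>N\<in>#branch_grafts t M. branch_grafts s N) + (\<Sum>w\<in>#grafts t s. branch_grafts w M) =
      (\<Sum>N\<in>#branch_grafts s M. branch_grafts t N) + (\<Sum>w\<in>#grafts s t. branch_grafts w M)"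
    by (rule branch_grafts_pre_lie) (rule Node.IH)
  then show ?case
    unfolding expand by (simp only: ac_simps add_mset_commute)
qed

section \<open>Sizes of grafts and induction over trees\<close>

lemma size_branch_grafts:
  assumes "\<And>t t'. t \<in># M \<Longrightarrow> t' \<in># grafts s t \<Longrightarrow> size t' = Suc (size s + size t)"
    and "N \<in># branch_grafts s M"
  shows "size_multiset size N = Suc (size s + size_multiset size M) \<and> size N = size M"
  using assms
proof (induction M arbitrary: N)
  case (add x M)
  then show ?case by (auto simp: size_multiset_add_mset)
qed simp

text \<open>The extra \<open>Suc\<close> is the new edge: \<open>size_multiset\<close> adds one for
  each branch.\<close>

lemma size_grafts: "t' \<in># grafts s t \<Longrightarrow> size t' = Suc (size s + size t)"
proof (induction t arbitrary: t')
  case (Node c M)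
  then show ?case
    using size_branch_grafts[of M s] by (auto simp: grafts_Node size_multiset_add_mset)
qed

text \<open>Here \<open>p\<close> stands for the product of the target. Its equation for grafting
  \<open>s\<close> onto \<open>Node c M\<close> can be solved for the value at
  \<open>Node c (add_mset s M)\<close>, the other values being known by induction.\<close>

lemma tree_function_unique:
  fixes f g :: "'c tree \<Rightarrow> 'a::ab_group_add"
  assumes f: "\<And>s t. (\<Sum>t'\<in>#grafts s t. f t') = p (f s) (f t)"
    and g: "\<And>s t. (\<Sum>t'\<in>#grafts s t. g t') = p (g s) (g t)"
    and one: "\<And>c. f (one_vertex c) = g (one_vertex c)"
  shows "f t = g t"
\<comment> \<open>Size comes first, then the number of root branches; the latter decides for the
  remaining grafts, which are as large as \<open>t\<close>.\<close>
proof (induction t rule: wf_induct_rule[OF wf_measures[of "[size, \<lambda>t. case t of Node c M \<Rightarrow> size M]"]])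
  case (1 t)
  obtain c L where t: "t = Node c L" by (cases t)
  show ?case
  proof (cases L)
    case empty
    then show ?thesis using one[of c] by (simp add: t one_vertex_def)
  next
    case (add s M)
    let ?r = "image_mset (Node c) (branch_grafts s M)"
    have "f s = g s" "f (Node c M) = g (Node c M)"
      by (auto intro!: 1 simp: t add size_multiset_add_mset)
    moreover have "f t' = g t'" if "t' \<in># ?r" for t'
    proof -
      from that obtain N where N: "N \<in># branch_grafts s M" "t' = Node c N" by auto
      have "size_multiset size N = Suc (size s + size_multiset size M) \<and> size N = size M"
        by (rule size_branch_grafts[OF _ N(1)]) (rule size_grafts)
      then show ?thesis by (intro 1) (simp add: N(2) t add size_multiset_add_mset)
    qed
    then have "sum_mset (image_mset f ?r) = sum_mset (image_mset g ?r)"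
      by (intro arg_cong[of _ _ sum_mset] image_mset_cong)
    ultimately show ?thesis
      using f[of s "Node c M"] g[of s "Node c M"]
        by (simp add: grafts_Node t add) (metis add_right_cancel)
  qed
qed

section \<open>Linear extension from the basis of trees\<close>

lemma lookup_fscale [simp]: "Poly_Mapping.lookup (fscale a x) t = a * Poly_Mapping.lookup x t"
  by (simp add: fscale_def Poly_Mapping.map.rep_eq when_def)

lemma vector_space_fscale: "vector_space fscale"
  by unfold_locales (auto intro!: poly_mapping_eqI simp: lookup_add algebra_simps)

lemma basis_expansion:
  "x = (\<Sum>t\<in>Poly_Mapping.keys x. fscale (Poly_Mapping.lookup x t) (basis t))"
  by (rule poly_mapping_eqI)
    (auto simp: lookup_sum basis_def lookup_single when_def in_keys_iff sum.delta if_distrib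
      cong: if_cong)

lemma basis_induct [case_names basis add scale]:
  fixes x :: "'x \<Rightarrow>\<^sub>0 'k::field"
  assumes basis: "\<And>t. P (basis t)"
    and add: "\<And>x y. P x \<Longrightarrow> P y \<Longrightarrow> P (x + y)"
    and scale: "\<And>a x. P x \<Longrightarrow> P (fscale a x)"
  shows "P x"
proof -
  \<comment> \<open>Zero needs no case of its own, being \<open>0\<close> times an arbitrary basis
    vector.\<close>
  have "P (fscale 0 (basis undefined))" by (intro basis scale)
  moreover have "fscale 0 (basis undefined :: 'x \<Rightarrow>\<^sub>0 'k) = 0"
    by (auto intro!: poly_mapping_eqI)
  ultimately have 0: "P 0" by simp
  have "P (\<Sum>t\<in>K. fscale (Poly_Mapping.lookup x t) (basis t))" if "finite K" for K
    using that by induction (auto intro: 0 basis add scale)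
  then show ?thesis by (subst basis_expansion) simp
qed

text \<open>With \<open>scale\<close> as an argument, one operator serves both the tree space and
  the target algebra.\<close>

definition linear_extension ::
  "('k::zero \<Rightarrow> 'b \<Rightarrow> 'b) \<Rightarrow> ('x \<Rightarrow> 'b) \<Rightarrow> ('x \<Rightarrow>\<^sub>0 'k) \<Rightarrow> 'b::comm_monoid_add" where
  "linear_extension scale f x =
     (\<Sum>t\<in>Poly_Mapping.keys x. scale (Poly_Mapping.lookup x t) (f t))"

context vector_space
begin

text \<open>Cancellation can shrink supports, so additivity needs a common index set for all
  terms.\<close>

lemma linear_extension_superset:
  assumes "finite K" "Poly_Mapping.keys x \<subseteq> K"
  shows "linear_extension scale f x = (\<Sum>t\<in>K. scale (Poly_Mapping.lookup x t) (f t))"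
  unfolding linear_extension_def using assms
  by (intro sum.mono_neutral_left) (auto simp: in_keys_iff)

lemma linear_extension_add: "linear_extension scale f (x + y) = linear_extension scale f x + linear_extension scale f y"
proof -
  let ?K = "Poly_Mapping.keys x \<union> Poly_Mapping.keys y"
  have "Poly_Mapping.keys (x + y) \<subseteq> ?K" by (rule keys_add)
  then show ?thesis
    by (simp add: linear_extension_superset[of ?K] lookup_add scale_left_distrib sum.distrib)
qed

lemma linear_extension_scale: "linear_extension scale f (fscale a x) = scale a (linear_extension scale f x)"
proof -
  have "Poly_Mapping.keys (fscale a x) \<subseteq> Poly_Mapping.keys x" by (auto simp: in_keys_iff)
  then show ?thesis
    by (simp add: linear_extension_superset[of "Poly_Mapping.keys x"] scale_sum_right)
qed

lemma linear_linear_extension: "Vector_Spaces.linear fscale scale (linear_extension scale f)"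
proof -
  interpret f: vector_space "fscale :: 'a \<Rightarrow> ('x \<Rightarrow>\<^sub>0 'a) \<Rightarrow> _" by (rule vector_space_fscale)
  show ?thesis
    by unfold_locales (simp_all add: linear_extension_add linear_extension_scale)
qed

lemma linear_extension_basis [simp]: "linear_extension scale f (basis t) = f t"
  by (simp add: linear_extension_def basis_def)

lemma linear_extension_add_fun:
  "linear_extension scale (\<lambda>t. f t + g t) x = linear_extension scale f x + linear_extension scale g x"
  by (simp add: linear_extension_def scale_right_distrib sum.distrib)

lemma linear_extension_scale_fun:
  "linear_extension scale (\<lambda>t. scale a (f t)) x = scale a (linear_extension scale f x)"
  by (simp add: linear_extension_def scale_sum_right mult.commute)

end

interpretation fspace: vector_space "fscale :: 'k::field \<Rightarrow> ('x \<Rightarrow>\<^sub>0 'k) \<Rightarrow> _"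
  by (rule vector_space_fscale)

section \<open>Bilinearity and the pre-Lie identity of the extended product\<close>

lemma graft_linear_extension:
  "graft x y = linear_extension fscale (\<lambda>s. linear_extension fscale (graft_basis s) y) x"
  by (simp add: graft_def linear_extension_def fspace.scale_sum_right)

lemma graft_add_left: "graft (x + x') y = graft x y + graft x' y"
  and graft_scale_left: "graft (fscale a x) y = fscale a (graft x y)"
  and graft_add_right: "graft x (y + y') = graft x y + graft x y'"
  and graft_scale_right: "graft x (fscale a y) = fscale a (graft x y)"
  by (simp_all add: graft_linear_extension fspace.linear_extension_add fspace.linear_extension_scale
      fspace.linear_extension_add_fun fspace.linear_extension_scale_fun)

lemma graft_basis_basis: "graft (basis s) (basis t) = (\<Sum>t'\<in>#grafts s t. basis t')"
  by (simp add: graft_linear_extension graft_basis_def)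

lemma graft_0_left [simp]: "graft 0 y = 0" and graft_0_right [simp]: "graft x 0 = 0"
  by (simp_all add: graft_def)

lemma graft_sum_mset_left: "graft (\<Sum>s\<in>#N. f s) y = (\<Sum>s\<in>#N. graft (f s) y)"
  by (induction N) (simp_all add: graft_add_left)

lemma graft_sum_mset_right: "graft x (\<Sum>t\<in>#N. f t) = (\<Sum>t\<in>#N. graft x (f t))"
  by (induction N) (simp_all add: graft_add_right)

lemma graft_pre_lie:
  "graft (graft x y) z - graft x (graft y z) = graft (graft y x) z - graft y (graft x z)"
  for x y z :: "'c tree \<Rightarrow>\<^sub>0 'k::field"
proof -
  \<comment> \<open>\<open>J\<close> is the difference of the two associators; it is trilinear, so
    it vanishes once it vanishes on trees.\<close>
  define J where "J x y z =
    (graft (graft x y) z + graft y (graft x z)) - (graft (graft y x) z + graft x (graft y z))"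
    for x y z :: "'c tree \<Rightarrow>\<^sub>0 'k"
  have "graft (graft (basis s) (basis t)) (basis u) + graft (basis t) (graft (basis s) (basis u)) =
      graft (graft (basis t) (basis s)) (basis u) +
      (graft (basis s) (graft (basis t) (basis u)) :: 'c tree \<Rightarrow>\<^sub>0 'k)" for s t u
    using arg_cong[OF grafts_pre_lie[of s t u], of "\<lambda>N. \<Sum>w\<in>#N. basis w :: 'c tree \<Rightarrow>\<^sub>0 'k"]
    by (simp add: graft_basis_basis graft_sum_mset_left graft_sum_mset_right sum_mset_sum_mset ac_simps)
  then have J_basis: "J (basis s) (basis t) (basis u) = 0" for s t u
    by (simp add: J_def)
  have J_add: "J (x + x') y z = J x y z + J x' y z" "J x (y + y') z = J x y z + J x y' z"
    "J x y (z + z') = J x y z + J x y z'" for x x' y y' z z'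
    by (simp_all add: J_def graft_add_left graft_add_right)
  have J_scale: "J (fscale a x) y z = fscale a (J x y z)" "J x (fscale a y) z = fscale a (J x y z)"
    "J x y (fscale a z) = fscale a (J x y z)" for a x y z
    by (simp_all add: J_def graft_scale_left graft_scale_right fspace.scale_right_distrib
        fspace.scale_right_diff_distrib)
  \<comment> \<open>Trees give way to arbitrary vectors first in \<open>x\<close> (the second fact),
    then in \<open>y\<close>, last in \<open>z\<close>.\<close>
  have "J x y (basis u) = 0" if "\<And>t. J x (basis t) (basis u) = 0" for x y u
    by (induction y rule: basis_induct) (simp_all add: that J_add J_scale)
  moreover have "J x (basis t) (basis u) = 0" for x t u
    by (induction x rule: basis_induct) (simp_all add: J_basis J_add J_scale)
  ultimately have "J x y (basis u) = 0" for x y u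
    by blast
  then have "J x y z = 0"
    by (induction z rule: basis_induct) (simp_all add: J_add J_scale)
  then show ?thesis by (simp add: J_def algebra_simps)
qed

lemma left_pre_lie_algebra_graft: "left_pre_lie_algebra fscale graft"
  by unfold_locales
    (simp_all add: graft_add_left graft_add_right graft_scale_left graft_scale_right graft_pre_lie)

section \<open>Symmetric braces and the value of a tree\<close>

context left_pre_lie_algebra
begin

lemma prd_add_right: "prd a (b + c) = prd a b + prd a c"
  and prd_diff_right: "prd a (b - c) = prd a b - prd a c"
  and prd_sum_right: "prd a (sum f I) = (\<Sum>i\<in>I. prd a (f i))"
  and prd_scale_right: "prd a (scale k b) = scale k (prd a b)"
proof -
  interpret r: Vector_Spaces.linear scale scale "\<lambda>b. prd a b"
    by (rule linear_right)
  show "prd a (b + c) = prd a b + prd a c" "prd a (b - c) = prd a b - prd a c"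
    "prd a (sum f I) = (\<Sum>i\<in>I. prd a (f i))" "prd a (scale k b) = scale k (prd a b)"
    by (rule r.add r.diff r.sum r.scale)+
qed

lemma prd_add_left: "prd (a + b) c = prd a c + prd b c"
  and prd_scale_left: "prd (scale k a) c = scale k (prd a c)"
proof -
  interpret l: Vector_Spaces.linear scale scale "\<lambda>a. prd a c"
    by (rule linear_left)
  show "prd (a + b) c = prd a c + prd b c" "prd (scale k a) c = scale k (prd a c)"
    by (rule l.add l.scale)+
qed

text \<open>The recursion singles out a head, so lists come first and independence of the order is
  proved afterwards.\<close>

function brace_list :: "'a list \<Rightarrow> 'a \<Rightarrow> 'a" where
  "brace_list [] b = b"
| "brace_list (a # xs) b =
     prd a (brace_list xs b) - (\<Sum>i<length xs. brace_list (xs[i := prd a (xs ! i)]) b)"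
  by pat_completeness auto
termination
  by (relation "measure (length \<circ> fst)") auto

lemma brace_list_add:
  "i < length xs \<Longrightarrow>
    brace_list (xs[i := u + v]) b = brace_list (xs[i := u]) b + brace_list (xs[i := v]) b"
proof (induction "length xs" arbitrary: xs i u v)
  case (Suc n)
  then obtain a ys where xs: "xs = a # ys" and n: "n = length ys"
    by (cases xs) auto
  note IH = Suc.hyps(1)[unfolded n]
  show ?case
  proof (cases i)
    case 0
    then show ?thesis
      by (simp add: xs prd_add_left IH sum.distrib algebra_simps)
  next
    case (Suc k)
    with Suc.prems have k: "k < length ys" by (simp add: xs)
    \<comment> \<open>For \<open>j = k\<close> the entry becomes \<open>prd a w\<close>, which is
      additive in \<open>w\<close>; otherwise the two updates commute.\<close>
    let ?S = "\<lambda>w j. brace_list (ys[k := w, j := prd a (ys[k := w] ! j)]) b"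
    have "?S (u + v) j = ?S u j + ?S v j" if j: "j < length ys" for j
    proof (cases "j = k")
      case True
      then show ?thesis using k by (simp add: prd_add_right IH)
    next
      case False
      then show ?thesis using k j by (simp add: list_update_swap[of k j] IH)
    qed
    then have "sum (?S (u + v)) {..<length ys} = sum (?S u) {..<length ys} + sum (?S v) {..<length ys}"
      by (simp add: sum.distrib)
    then show ?thesis using k by (simp add: xs Suc IH prd_add_right)
  qed
qed simp

lemma brace_list_diff:
  assumes "i < length xs"
  shows "brace_list (xs[i := u - v]) b = brace_list (xs[i := u]) b - brace_list (xs[i := v]) b"
  using brace_list_add[OF assms, of "u - v" v b] by simp

text \<open>Two unfoldings of the recursion leave an antisymmetric part in which the commutator of
  \<open>x\<close> and \<open>y\<close> acts; the pre-Lie identity makes it cancel.\<close>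

lemma brace_list_swap: "brace_list (x # y # xs) b = brace_list (y # x # xs) b"
proof -
  let ?I = "{..<length xs}"
  define B where "B = brace_list xs b"
  define R where "R u i = brace_list (xs[i := u]) b" for u i
  define D where "D x y i j = brace_list (xs[i := prd x (xs ! i), j := prd y (xs[i := prd x (xs ! i)] ! j)]) b"
    for x y i j
  \<comment> \<open>The two single sums together are symmetric in \<open>x\<close> and
    \<open>y\<close>; the other three terms have to be compared.\<close>
  have expand: "brace_list (x # y # xs) b =
      prd x (prd y B) - (\<Sum>i\<in>?I. prd x (R (prd y (xs ! i)) i)) - (\<Sum>i\<in>?I. prd y (R (prd x (xs ! i)) i))
      - brace_list (prd x y # xs) b + (\<Sum>i\<in>?I. \<Sum>j\<in>?I. D x y i j)" for x y
    by (simp add: B_def R_def D_def sum.lessThan_Suc_shift prd_diff_right prd_sum_right sum_subtractf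
        algebra_simps del: sum.lessThan_Suc)
  \<comment> \<open>Updates at distinct positions commute, so only the diagonal of the double sum
    survives antisymmetrization.\<close>
  have D_off: "D x y i j = D y x j i" if "i \<noteq> j" for i j
    using that by (simp add: D_def list_update_swap[of i j])
  have D_diag: "D x y i i = R (prd y (prd x (xs ! i))) i" if "i \<in> ?I" for x y i
    using that by (simp add: D_def R_def)
  \<comment> \<open>The pre-Lie identity says that left multiplication by a commutator is the
    commutator of left multiplications.\<close>
  have lie: "prd (prd x y) c - prd (prd y x) c = prd x (prd y c) - prd y (prd x c)" for c
    using left_pre_lie[of x y c] by (simp add: algebra_simps)
  have "(\<Sum>i\<in>?I. \<Sum>j\<in>?I. D y x i j) = (\<Sum>i\<in>?I. \<Sum>j\<in>?I. D y x j i)"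
    by (rule sum.swap)
  then have "(\<Sum>i\<in>?I. \<Sum>j\<in>?I. D x y i j) - (\<Sum>i\<in>?I. \<Sum>j\<in>?I. D y x i j) =
      (\<Sum>i\<in>?I. \<Sum>j\<in>?I. D x y i j - D y x j i)"
    by (simp add: sum_subtractf)
  also have "\<dots> = (\<Sum>i\<in>?I. \<Sum>j\<in>?I. if j = i then D x y i i - D y x i i else 0)"
    using D_off by (intro sum.cong refl) auto
  also have "\<dots> = (\<Sum>i\<in>?I. R (prd y (prd x (xs ! i))) i - R (prd x (prd y (xs ! i))) i)"
    by (simp add: D_diag)
  finally have D_diff: "(\<Sum>i\<in>?I. \<Sum>j\<in>?I. D x y i j) - (\<Sum>i\<in>?I. \<Sum>j\<in>?I. D y x i j) =
      (\<Sum>i\<in>?I. R (prd y (prd x (xs ! i))) i - R (prd x (prd y (xs ! i))) i)" .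
  have "R (prd (prd x y) (xs ! i)) i - R (prd (prd y x) (xs ! i)) i =
      R (prd x (prd y (xs ! i))) i - R (prd y (prd x (xs ! i))) i" if "i \<in> ?I" for i
    using that by (simp add: R_def brace_list_diff[symmetric] lie)
  then have "(\<Sum>i\<in>?I. R (prd (prd x y) (xs ! i)) i) - (\<Sum>i\<in>?I. R (prd (prd y x) (xs ! i)) i) =
      (\<Sum>i\<in>?I. R (prd x (prd y (xs ! i))) i - R (prd y (prd x (xs ! i))) i)"
    by (simp add: sum_subtractf[symmetric])
  then have "brace_list (prd x y # xs) b - brace_list (prd y x # xs) b =
      prd x (prd y B) - prd y (prd x B) + (\<Sum>i\<in>?I. R (prd y (prd x (xs ! i))) i - R (prd x (prd y (xs ! i))) i)"
    using lie[of B] by (simp add: R_def[symmetric] B_def[symmetric] sum_subtractf algebra_simps)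
  then have "brace_list (x # y # xs) b - brace_list (y # x # xs) b = 0"
    unfolding expand using D_diff by (simp add: algebra_simps)
  then show ?thesis by simp
qed

text \<open>The listing is arbitrary; \<open>brace_list_perm\<close> shows that the choice does not
  matter.\<close>

definition brace :: "'a multiset \<Rightarrow> 'a \<Rightarrow> 'a" where
  "brace M b = brace_list (SOME xs. mset xs = M) b"

text \<open>Equal heads reduce to shorter lists through the recursion; distinct heads are exchanged
  by \<open>brace_list_swap\<close>.\<close>

lemma brace_list_perm: "mset xs = mset ys \<Longrightarrow> brace_list xs b = brace_list ys b"
proof (induction "length xs" arbitrary: xs ys rule: less_induct)
  case less
  \<comment> \<open>Below the current length the induction hypothesis already makes
    \<open>brace\<close> independent of the listing.\<close>
  have brace: "brace_list zs b = brace (mset zs) b" if "length zs < length xs" for zs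
    unfolding brace_def using that
    by (metis (mono_tags, lifting) less.hyps someI)
  \<comment> \<open>The recursion's sum over positions becomes a sum over the multiset of the
    tail.\<close>
  have same_head: "brace_list (x # us) b = brace_list (x # vs) b"
    if us: "length us < length xs" and uv: "mset us = mset vs" for x us vs
  proof -
    have *: "(\<Sum>i<length ws. brace_list (ws[i := prd x (ws ! i)]) b) =
        (\<Sum>z\<in>#mset ws. brace (add_mset (prd x z) (mset ws - {#z#})) b)"
      if "length ws < length xs" for ws
    proof -
      have "(\<Sum>z\<in>#mset ws. brace (add_mset (prd x z) (mset ws - {#z#})) b) =
          (\<Sum>i<length ws. brace (add_mset (prd x (ws ! i)) (mset ws - {#ws ! i#})) b)"
        by (simp only: mset_map[symmetric] sum_mset_sum_list)
          (simp add: sum_list_sum_nth atLeast0LessThan)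
      also have "\<dots> = (\<Sum>i<length ws. brace_list (ws[i := prd x (ws ! i)]) b)"
        using that by (intro sum.cong refl) (simp add: brace mset_update)
      finally show ?thesis by simp
    qed
    have "length vs = length us" using uv by (metis size_mset)
    then show ?thesis using us uv less.hyps[of us vs] *[of us] *[of vs] by simp
  qed
  show ?case
  proof (cases xs)
    case Nil
    then show ?thesis using less.prems by simp
  next
    case (Cons x us)
    then obtain y vs where ys: "ys = y # vs" using less.prems by (cases ys) auto
    have eq: "add_mset x (mset us) = add_mset y (mset vs)"
      using less.prems Cons ys by simp
    show ?thesis
    proof (cases "x = y")
      case True
      then show ?thesis using eq same_head[of us vs x] by (simp add: Cons ys del: brace_list.simps)
    next
      case False
      with eq obtain N where N: "mset us = add_mset y N" "mset vs = add_mset x N"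
        by (auto simp: add_eq_conv_ex)
      \<comment> \<open>Removing both heads leaves the common rest \<open>ws\<close>; the two lists
        meet at \<open>x # y # ws\<close> and \<open>y # x # ws\<close>.\<close>
      obtain ws where ws: "mset ws = N" using ex_mset by blast
      have len: "length vs = length us" using N by (metis size_mset size_add_mset)
      have "brace_list (x # us) b = brace_list (x # y # ws) b"
        using N ws by (intro same_head) (auto simp: Cons)
      also have "\<dots> = brace_list (y # x # ws) b" by (rule brace_list_swap)
      also have "\<dots> = brace_list (y # vs) b"
        using N ws len by (intro same_head[symmetric]) (auto simp: Cons)
      finally show ?thesis by (simp only: Cons ys)
    qed
  qed
qed

lemma brace_mset: "brace (mset xs) b = brace_list xs b"
  unfolding brace_def by (rule brace_list_perm) (rule someI[of _ xs], rule refl)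

lemma brace_empty [simp]: "brace {#} b = b"
  using brace_mset[of "[]" b] by simp

lemma brace_add_mset:
  "brace (add_mset a M) b = prd a (brace M b) - (\<Sum>x\<in>#M. brace (add_mset (prd a x) (M - {#x#})) b)"
proof -
  obtain xs where M: "M = mset xs" using ex_mset by metis
  have "(\<Sum>x\<in>#mset xs. brace (add_mset (prd a x) (mset xs - {#x#})) b) =
      (\<Sum>i<length xs. brace (add_mset (prd a (xs ! i)) (mset xs - {#xs ! i#})) b)"
    by (simp only: mset_map[symmetric] sum_mset_sum_list)
      (simp add: sum_list_sum_nth atLeast0LessThan)
  also have "\<dots> = (\<Sum>i<length xs. brace_list (xs[i := prd a (xs ! i)]) b)"
    by (intro sum.cong refl) (simp add: brace_mset[symmetric] mset_update)
  finally show ?thesis using brace_mset[of "a # xs" b] by (simp add: M brace_mset)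
qed

lemma brace_add: "brace (add_mset (u + v) M) b = brace (add_mset u M) b + brace (add_mset v M) b"
proof -
  obtain xs where M: "M = mset xs" using ex_mset by metis
  show ?thesis
    using brace_list_add[of 0 "u # xs" u v b] brace_mset[of "_ # xs" b]
    by (simp add: M del: brace_list.simps)
qed

lemma brace_sum_mset: "brace (add_mset (\<Sum>x\<in>#N. f x) M) b = (\<Sum>x\<in>#N. brace (add_mset (f x) M) b)"
proof (induction N)
  case empty
  \<comment> \<open>Additivity at \<open>0 + 0\<close> forces the value zero.\<close>
  show ?case using brace_add[of 0 0 M b] by simp
qed (simp add: brace_add)

section \<open>Evaluation of trees\<close>

primrec tree_eval :: "('c \<Rightarrow> 'a) \<Rightarrow> 'c tree \<Rightarrow> 'a" where
  "tree_eval a (Node c M) = brace (image_mset (tree_eval a) M) (a c)"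

text \<open>Grafting at the root gives the brace enlarged by the value of \<open>s\<close>; grafting
  into branches gives, by induction and additivity, the sum subtracted in
  \<open>brace_add_mset\<close>. Only the product remains.\<close>

lemma tree_eval_grafts: "(\<Sum>t'\<in>#grafts s t. tree_eval a t') = prd (tree_eval a s) (tree_eval a t)"
proof (induction t)
  case (Node c M)
  let ?F = "tree_eval a"
  have branch: "(\<Sum>t'\<in>#grafts s t. ?F (Node c (add_mset t' (M - {#t#})))) =
      brace (add_mset (prd (?F s) (?F t)) (image_mset ?F M - {#?F t#})) (a c)" if "t \<in># M" for t
    using that by (simp add: brace_sum_mset[symmetric] Node.IH image_mset_Diff)
  have "(\<Sum>t'\<in>#grafts s (Node c M). ?F t') =
      brace (add_mset (?F s) (image_mset ?F M)) (a c) +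
      (\<Sum>t\<in>#M. \<Sum>t'\<in>#grafts s t. ?F (Node c (add_mset t' (M - {#t#}))))"
    by (simp add: grafts.simps sum_mset_sum_mset multiset.map_comp o_def)
  also have "(\<Sum>t\<in>#M. \<Sum>t'\<in>#grafts s t. ?F (Node c (add_mset t' (M - {#t#})))) =
      (\<Sum>t\<in>#M. brace (add_mset (prd (?F s) (?F t)) (image_mset ?F M - {#?F t#})) (a c))"
    using branch by (intro arg_cong[of _ _ sum_mset] image_mset_cong)
  finally show ?case by (simp add: brace_add_mset[of "?F s"] multiset.map_comp o_def)
qed

end

section \<open>Freeness\<close>

lemma linear_basis_sum_mset:
  assumes "Vector_Spaces.linear fscale scale F"
  shows "F (\<Sum>t\<in>#N. basis t) = (\<Sum>t\<in>#N. F (basis t))"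
proof -
  interpret F: Vector_Spaces.linear fscale scale F by (rule assms)
  show ?thesis by (induction N) (simp_all add: F.zero F.add)
qed

lemma linear_basis_unique:
  assumes "Vector_Spaces.linear fscale scale F" "Vector_Spaces.linear fscale scale G"
    and "\<And>t. F (basis t) = G (basis t)"
  shows "F = G"
proof
  fix x
  interpret F: Vector_Spaces.linear fscale scale F by (rule assms)
  interpret G: Vector_Spaces.linear fscale scale G by (rule assms)
  show "F x = G x"
    by (induction x rule: basis_induct) (simp_all add: assms(3) F.add G.add F.scale G.scale)
qed

text \<open>The colours form a finite type; since types are nonempty, this encodes
  \<open>d >= 1\<close>.\<close>

theorem theorem22:
  "left_pre_lie_algebra (fscale :: 'k::field_char_0 \<Rightarrow> ('c::finite tree \<Rightarrow>\<^sub>0 'k) \<Rightarrow> _) graft \<and>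
   (\<forall>(scaleA :: 'k \<Rightarrow> 'a::ab_group_add \<Rightarrow> 'a) (prdA :: 'a \<Rightarrow> 'a \<Rightarrow> 'a) (a :: 'c \<Rightarrow> 'a).
      left_pre_lie_algebra scaleA prdA \<longrightarrow>
      (\<exists>!F :: ('c tree \<Rightarrow>\<^sub>0 'k) \<Rightarrow> 'a.
         pre_lie_morphism fscale graft scaleA prdA F \<and>
         (\<forall>i. F (basis (one_vertex i)) = a i)))"
proof (intro conjI allI impI)
  show "left_pre_lie_algebra (fscale :: 'k \<Rightarrow> ('c tree \<Rightarrow>\<^sub>0 'k) \<Rightarrow> _) graft"
    by (rule left_pre_lie_algebra_graft)
next
  fix scaleA :: "'k \<Rightarrow> 'a \<Rightarrow> 'a" and prdA :: "'a \<Rightarrow> 'a \<Rightarrow> 'a" and a :: "'c \<Rightarrow> 'a"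
  assume "left_pre_lie_algebra scaleA prdA"
  then interpret A: left_pre_lie_algebra scaleA prdA .
  define F :: "('c tree \<Rightarrow>\<^sub>0 'k) \<Rightarrow> 'a" where "F = linear_extension scaleA (A.tree_eval a)"
  have linear_F: "Vector_Spaces.linear fscale scaleA F"
    unfolding F_def by (rule A.linear_linear_extension)
  interpret F: Vector_Spaces.linear fscale scaleA F by (rule linear_F)
  have F_basis: "F (basis t) = A.tree_eval a t" for t
    by (simp add: F_def)
  have F_graft: "F (graft x y) = prdA (F x) (F y)" for x y
  proof (induction x rule: basis_induct)
    case (basis s)
    show ?case
    proof (induction y rule: basis_induct)
      case (basis t)
      show ?case
        by (simp add: graft_basis_basis linear_basis_sum_mset[OF linear_F] F_basis A.tree_eval_grafts)
    qed (simp_all add: graft_add_right graft_scale_right F.add F.scale A.prd_add_right A.prd_scale_right)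
  qed (simp_all add: graft_add_left graft_scale_left F.add F.scale A.prd_add_left A.prd_scale_left)
  show "\<exists>!F :: ('c tree \<Rightarrow>\<^sub>0 'k) \<Rightarrow> 'a.
      pre_lie_morphism fscale graft scaleA prdA F \<and> (\<forall>i. F (basis (one_vertex i)) = a i)"
  proof (rule ex1I[of _ F])
    show "pre_lie_morphism fscale graft scaleA prdA F \<and> (\<forall>i. F (basis (one_vertex i)) = a i)"
      using linear_F F_graft by (simp add: pre_lie_morphism_def F_basis one_vertex_def)
  next
    fix G :: "('c tree \<Rightarrow>\<^sub>0 'k) \<Rightarrow> 'a"
    assume G: "pre_lie_morphism fscale graft scaleA prdA G \<and> (\<forall>i. G (basis (one_vertex i)) = a i)"
    then have linear_G: "Vector_Spaces.linear fscale scaleA G"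
      and G_graft: "G (graft x y) = prdA (G x) (G y)" for x y
      by (auto simp: pre_lie_morphism_def)
    \<comment> \<open>On trees, \<open>G\<close> and \<open>tree_eval\<close> obey the same grafting
      equation and agree on single vertices.\<close>
    have "G (basis t) = A.tree_eval a t" for t
    proof (rule tree_function_unique[of _ prdA])
      show "(\<Sum>t'\<in>#grafts s t. G (basis t')) = prdA (G (basis s)) (G (basis t))" for s t
        by (simp add: linear_basis_sum_mset[OF linear_G, symmetric] graft_basis_basis[symmetric] G_graft)
    qed (use G in \<open>simp_all add: A.tree_eval_grafts one_vertex_def\<close>)
    then show "G = F"
      by (intro linear_basis_unique[OF linear_G linear_F]) (simp add: F_basis)
  qed
qed

end
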